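(* Let $\bm{1}=(1,\dots,1)^{\mathrm{T}}\in\mathbb{R}^{dN}$ and assume that the system is isolated, i.e. $\bm{1}^{\mathrm{T}} \nabla V(\bm{q}) = 0$ for all $\bm{q}\in \mathbb{R}^{dN}$. Let the sequences $(\bm{q}^n)_{n\ge 0}$ and $(\bm{p}^{n-1/2})_{n\ge 0}$ be generated by the scheme described in the context, with the initialization given there. Then the total momentum $P_{n+1/2}:= \bm{1}^{\mathrm{T}} \bm{p}^{n+1/2}$, $n\ge 0$, is conserved, i.e. $P_{n+1/2}=P_{1/2}$ for all $n\ge 0$.
   Context: Let $d,N\ge 1$ be integers, let $\bm{M}\in\mathbb{R}^{dN\times dN}$ be a symmetric positive definite (mass) matrix, and let $V\in C^2(\mathbb{R}^{dN};\mathbb{R})$ be the potential energy. Discrete time nodes $t^0<t^1<\cdots$ are given, with $h_n=t^{n+1}-t^n>0$ and $I_n=[t^n,t^{n+1}]$. The scheme, in two-step form, at step $n\ge0$ is: knowing $\bm{p}^{n-1/2}$, $\bm{q}^n$, $\bm{p}^{n+1/2}\in\mathbb{R}^{dN}$, compute $$\bm{q}^{n+1} = \bm{q}^n + h_n \bm{M}^{-1}\bm{p}^{n+1/2},\qquad \frac{1}{2} \left(\bm{p}^{n+3/2} - \bm{p}^{n-1/2} \right) = -\int_{I_n} \nabla V(\bm{\hat{q}}^n(t))\, dt,$$ where $\bm{\hat{q}}^n(t) = \bm{q}^n + (t - t^n)\bm{M}^{-1}\bm{p}^{n+1/2}$ for $t\in I_n$. The initialization is $\bm{p}^{-1/2}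 = \bm{p}(t^0)$, $\bm{q}^0 = \bm{q}(t^0)$, $\bm{p}^{1/2} = \bm{p}(t^0)$ (equivalently, the momentum jump $\bm p^{1/2}-\bm p^{-1/2}$ at $t^0$ is zero), where $\bm{q}(t^0),\bm{p}(t^0)\in\mathbb{R}^{dN}$ are given initial position and momentum vectors. *)

theory Defs
  imports "HOL-Analysis.Analysis"
begin

definition symmetric_positive_definite :: "real ^ 'k ^ 'k \<Rightarrow> bool" where
  "symmetric_positive_definite A \<longleftrightarrow>
     transpose A = A \<and> (\<forall>x. x \<noteq> 0 \<longrightarrow> x \<bullet> (A *v x) > 0)"

definition gradient :: "(real ^ 'k \<Rightarrow> real) \<Rightarrow> real ^ 'k \<Rightarrow> real ^ 'k" where
  "gradient V x = (THE D. GDERIV V x :> D)"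

lemma gradient_eqI:
  assumes "GDERIV V x :> D"
  shows "gradient V x = D"
  unfolding gradient_def
proof (rule the_equality)
  fix D' assume "GDERIV V x :> D'"
  then have "(\<lambda>h. h \<bullet> D') = (\<lambda>h. h \<bullet> D)"
    using assms unfolding gderiv_def by (rule has_derivative_unique)
  then have "\<forall>h. h \<bullet> D' = h \<bullet> D"
    by (simp add: fun_eq_iff)
  then show "D' = D"
    by (simp only: vector_eq_ldot)
qed (rule assms)

(* Membership in C^2 on the whole space; H is the Hessian matrix field. *)
definition C2 :: "(real ^ 'k \<Rightarrow> real) \<Rightarrow> bool" where
  "C2 V \<longleftrightarrow>
     (\<forall>x. GDERIV V x :> gradient V x) \<and>
     (\<exists>H :: real ^ 'k \<Rightarrow> real ^ 'k ^ 'k.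
        (\<forall>x. (gradient V has_derivative (\<lambda>h. H x *v h)) (at x)) \<and>
        continuous_on UNIV H)"

(* Half-integer momentum indices are shifted: p n stands for p^(n-1/2),
   hence p (n+1) for p^(n+1/2) and p (n+2) for p^(n+3/2). *)

definition q_hat ::
  "real ^ 'k ^ 'k \<Rightarrow> (nat \<Rightarrow> real) \<Rightarrow> (nat \<Rightarrow> real ^ 'k) \<Rightarrow> (nat \<Rightarrow> real ^ 'k) \<Rightarrow>
   nat \<Rightarrow> real \<Rightarrow> real ^ 'k" where
  "q_hat M t q p n s = q n + (s - t n) *\<^sub>R (matrix_inv M *v p (n + 1))"

definition scheme_step ::
  "real ^ 'k ^ 'k \<Rightarrow> (real ^ 'k \<Rightarrow> real) \<Rightarrow> (nat \<Rightarrow> real) \<Rightarrow>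
   (nat \<Rightarrow> real ^ 'k) \<Rightarrow> (nat \<Rightarrow> real ^ 'k) \<Rightarrow> nat \<Rightarrow> bool" where
  "scheme_step M V t q p n \<longleftrightarrow>
     q (n + 1) = q n + (t (n + 1) - t n) *\<^sub>R (matrix_inv M *v p (n + 1)) \<and>
     (1 / 2) *\<^sub>R (p (n + 2) - p n) =
       - integral {t n..t (n + 1)} (\<lambda>s. gradient V (q_hat M t q p n s))"

definition generated_by_scheme ::
  "real ^ 'k ^ 'k \<Rightarrow> (real ^ 'k \<Rightarrow> real) \<Rightarrow> (nat \<Rightarrow> real) \<Rightarrow> real ^ 'k \<Rightarrow> real ^ 'k \<Rightarrow>
   (nat \<Rightarrow> real ^ 'k) \<Rightarrow> (nat \<Rightarrow> real ^ 'k) \<Rightarrow> bool" where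
  "generated_by_scheme M V t q_init p_init q p \<longleftrightarrow>
     p 0 = p_init \<and> q 0 = q_init \<and> p 1 = p_init \<and>
     (\<forall>n. scheme_step M V t q p n)"

(* total_momentum p n is P_(n+1/2) *)
definition total_momentum :: "(nat \<Rightarrow> real ^ 'k) \<Rightarrow> nat \<Rightarrow> real" where
  "total_momentum p n = vec 1 \<bullet> p (n + 1)"

end

theory Submission
  imports Defs
begin

text \<open>
  Pairing the momentum update with the vector of ones turns the force integral into the integral
  of a function that vanishes identically, because the system is isolated; pulling the constant
  vector inside the integral needs integrability of the force, which follows from the continuity of
  the gradient along the affine path travelled during a time step. So the total momentum is the
  same at \<open>n + 3/2\<close> and \<open>n - 1/2\<close>. As the scheme links momenta two half-integer indices
  apart, this yields two separate conserved quantities, one for each parity of the index, and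
  it is the initialization with zero momentum jump at \<open>t\<^sup>0\<close> that makes them equal.
\<close>

lemma continuous_on_gradient_C2:
  assumes "C2 V"
  shows "continuous_on UNIV (gradient V)"
  using assms unfolding C2_def
  by (metis continuous_at_imp_continuous_on has_derivative_continuous)

lemma inner_integral_eq_0:
  fixes f :: "'a::euclidean_space \<Rightarrow> 'b::euclidean_space"
  assumes "f integrable_on S" and "\<And>x. x \<in> S \<Longrightarrow> c \<bullet> f x = 0"
  shows "c \<bullet> integral S f = 0"
proof -
  have "c \<bullet> integral S f = integral S (\<lambda>x. c \<bullet> f x)"
    using integral_linear[OF assms(1) bounded_linear_inner_right, of c] by (simp add: o_def)
  also have "\<dots> = integral S (\<lambda>x. 0)"
    by (rule integral_cong) (rule assms(2))
  finally show ?thesis by simp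
qed

lemma force_integrable:
  assumes "C2 V"
  shows "(\<lambda>s. gradient V (q_hat M t q p n s)) integrable_on {a..b}"
proof (rule integrable_continuous_real)
  have "continuous_on {a..b} (q_hat M t q p n)"
    unfolding q_hat_def by (intro continuous_intros)
  then show "continuous_on {a..b} (\<lambda>s. gradient V (q_hat M t q p n s))"
    by (rule continuous_on_compose2[OF continuous_on_gradient_C2[OF assms]]) simp
qed

text \<open>
  Orthogonality of \<open>c\<close> to every force says that the potential is invariant under translations
  along \<open>c\<close>; the vector of ones is the case of a uniform shift of all coordinates.
\<close>
lemma scheme_step_inner_eq:
  assumes "C2 V" and "\<And>x. c \<bullet> gradient V x = 0" and "scheme_step M V t q p n"
  shows "c \<bullet> p (n + 2) = c \<bullet> p n"
proof -
  have "c \<bullet> ((1 / 2) *\<^sub>R (p (n + 2) - p n)) =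
      - (c \<bullet> integral {t n..t (n + 1)} (\<lambda>s. gradient V (q_hat M t q p n s)))"
    using assms(3) unfolding scheme_step_def by simp
  also have "\<dots> = 0"
    using inner_integral_eq_0[OF force_integrable[OF assms(1)] assms(2)] by simp
  finally show ?thesis by (simp add: inner_diff_right)
qed

text \<open>
  Without agreement of the first two values, \<open>f\<close> could alternate with the parity of its index.
\<close>
lemma two_step_constant:
  fixes f :: "nat \<Rightarrow> 'a"
  assumes "\<And>n. f (n + 2) = f n" and "f 1 = f 0"
  shows "f n = f 0"
proof (induction n rule: induct_nat_012)
  case 1
  show ?case using assms(2) by simp
next
  case (ge2 n)
  then show ?case using assms(1)[of n] by simp
qed simp

theorem mainTheorem2:
  fixes M :: "real ^ ('d::finite \<times> 'N::finite) ^ ('d \<times> 'N)"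
    and V :: "real ^ ('d \<times> 'N) \<Rightarrow> real"
    and t :: "nat \<Rightarrow> real"
    and q_init p_init :: "real ^ ('d \<times> 'N)"
    and q p :: "nat \<Rightarrow> real ^ ('d \<times> 'N)"
  assumes mass: "symmetric_positive_definite M"
    and potential: "C2 V"
    and nodes: "\<forall>n. t n < t (n + 1)"
    and isolated: "\<forall>x. vec 1 \<bullet> gradient V x = 0"
    and scheme: "generated_by_scheme M V t q_init p_init q p"
  shows "\<forall>n. total_momentum p n = total_momentum p 0"
proof
  fix n
  have "vec 1 \<bullet> p (m + 2) = vec 1 \<bullet> p m" for m
    using scheme_step_inner_eq[OF potential] isolated scheme
    unfolding generated_by_scheme_def by blast
  moreover have "vec 1 \<bullet> p 1 = vec 1 \<bullet> p 0"
    using scheme unfolding generated_by_scheme_def by simp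
  ultimately have const: "vec 1 \<bullet> p m = vec 1 \<bullet> p 0" for m
    by (rule two_step_constant)
  show "total_momentum p n = total_momentum p 0"
    unfolding total_momentum_def using const[of "n + 1"] const[of "0 + 1"] by simp
qed

end
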